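(* Let $M\ge 1$ be the number of customers, and let $\gamma>0$ and $r=r(q)>0$ be fixed (the data size $q$ is fixed). Let $F$ be the uniform distribution on $[0,\gamma r]$ with density $f$, and let $\phi(b)=b-\frac{1-F(b)}{f(b)}$ for $b\in[0,\gamma r]$. Consider the Bayesian digital goods auction which, on input sealed bids $\mathbf b=(b_1,\dots,b_M)\in[0,\gamma r]^M$, allocates the service to customer $i$ (sets $x_i(\mathbf b)=1$) if and only if $\phi(b_i)\ge 0$, charges every winning customer $p_i(\mathbf b)=\inf\{b\in[0,\gamma r]:\phi(b)\ge 0\}=\phi^{-1}(0)$, and charges $p_i(\mathbf b)=0$ to every customer with $x_i(\mathbf b)=0$. Customer $i$ with valuation $v_i\in[0,\gamma r]$ has utility $u_i(\mathbf b)=v_i\,x_i(\mathbf b)-p_i(\mathbf b)$. Then: (1) (Incentive compatibility) For every customer $i$, every valuation $v_i\in[0,\gamma r]$, every bids $\mathbf b_{-i}\in[0,\gamma r]^{M-1}$ of the other customers and every bid $b_i\in[0,\gamma r]$, one has $u_i(v_i,\mathbf b_{-i})\ge u_i(b_i,\mathbf b_{-i})$. (2) (Individual rationality) For every customer $i$, every $v_i\in[0,\gamma r]$ and every $\mathbf b_{-i}\in[0,\gamma r]^{M-1}$, one has $u_i(v_i,\mathbf b_{-i})\ge 0$. (3) (Computational efficiency) The list of winners can be computed in polynomial time, with $O(1)$ arithmetic operations and comparisons per customer.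
   Context: A service provider sells licenses of a big data service (a digital good with unlimited supply and no marginal cost per license) to $M$ customers. The number $r(q)$ is the service performance obtained from $q$ units of data, and $\gamma$ is the influence coefficient of performance on valuation. Customer $i$ has valuation $v_i=d_i\,r(q)\,\gamma$, where $d_1,\dots,d_M$ are independent and uniform on $[0,1]$, so the $v_i$ are i.i.d. uniform on $[0,\gamma r(q)]$, with $F(v)=\frac{v}{\gamma r(q)}$ and $f(v)=\frac{1}{\gamma r(q)}$ on this interval. The function $\phi$ is called the virtual valuation. $(b_i,\mathbf b_{-i})$ denotes the bid vector in which customer $i$ bids $b_i$ and the others bid $\mathbf b_{-i}$. *)

theory Defs
  imports "HOL-Probability.Probability" "HOL-Computational_Algebra.Polynomial"
begin

section \<open>The auction\<close>

text \<open>Customers are numbered \<open>0, \<dots>, M - 1\<close>. The fixed data size enters only through the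
  service performance \<open>r = r(q)\<close>.\<close>

definition valuation_measure :: "real \<Rightarrow> real \<Rightarrow> real measure" where
  "valuation_measure \<gamma> r = uniform_measure lborel {0..\<gamma> * r}"

definition valuation_cdf :: "real \<Rightarrow> real \<Rightarrow> real \<Rightarrow> real" where
  "valuation_cdf \<gamma> r = cdf (valuation_measure \<gamma> r)"

definition valuation_density :: "real \<Rightarrow> real \<Rightarrow> real \<Rightarrow> real" where
  "valuation_density \<gamma> r v = indicator {0..\<gamma> * r} v / measure lborel {0..\<gamma> * r}"

definition virtual_valuation :: "real \<Rightarrow> real \<Rightarrow> real \<Rightarrow> real" where
  "virtual_valuation \<gamma> r b = b - (1 - valuation_cdf \<gamma> r b) / valuation_density \<gamma> r b"

definition bid_profiles :: "nat \<Rightarrow> real \<Rightarrow> real \<Rightarrow> real list set" where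
  "bid_profiles n \<gamma> r = {b. length b = n \<and> set b \<subseteq> {0..\<gamma> * r}}"

text \<open>The bid vector in which customer \<open>i\<close> bids \<open>w\<close> and the list \<open>bs\<close>, of length \<open>M - 1\<close>,
  contains the bids of the other customers.\<close>

definition with_bid :: "nat \<Rightarrow> real \<Rightarrow> real list \<Rightarrow> real list" where
  "with_bid i w bs = take i bs @ w # drop i bs"

definition allocation :: "real \<Rightarrow> real \<Rightarrow> real list \<Rightarrow> nat \<Rightarrow> real" where
  "allocation \<gamma> r b i = (if virtual_valuation \<gamma> r (b ! i) \<ge> 0 then 1 else 0)"

definition price :: "real \<Rightarrow> real \<Rightarrow> real" where
  "price \<gamma> r = Inf {b \<in> {0..\<gamma> * r}. virtual_valuation \<gamma> r b \<ge> 0}"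

definition payment :: "real \<Rightarrow> real \<Rightarrow> real list \<Rightarrow> nat \<Rightarrow> real" where
  "payment \<gamma> r b i = (if allocation \<gamma> r b i = 1 then price \<gamma> r else 0)"

definition utility :: "real \<Rightarrow> real \<Rightarrow> real \<Rightarrow> nat \<Rightarrow> real list \<Rightarrow> real" where
  "utility \<gamma> r v i b = v * allocation \<gamma> r b i - payment \<gamma> r b i"

definition winners :: "real \<Rightarrow> real \<Rightarrow> real list \<Rightarrow> nat list" where
  "winners \<gamma> r b = filter (\<lambda>i. allocation \<gamma> r b i = 1) [0..<length b]"

lemma valuation_measure_eq_density:
  assumes "\<gamma> > 0" "r > 0"
  shows "valuation_measure \<gamma> r = density lborel (\<lambda>v. ennreal (valuation_density \<gamma> r v))"
proof -
  have pos: "\<gamma> * r > 0" using assms by simp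
  have "(\<lambda>v. indicator {0..\<gamma> * r} v / emeasure lborel {0..\<gamma> * r}) = (\<lambda>v. ennreal (valuation_density \<gamma> r v))"
    using pos by (auto simp: fun_eq_iff valuation_density_def indicator_def divide_ennreal ennreal_1[symmetric]
        simp del: ennreal_1)
  then show ?thesis by (simp add: valuation_measure_def uniform_measure_def)
qed

lemma valuation_cdf_eq:
  assumes "\<gamma> > 0" "r > 0" "v \<in> {0..\<gamma> * r}"
  shows "valuation_cdf \<gamma> r v = v / (\<gamma> * r)"
proof -
  have pos: "\<gamma> * r > 0" using assms by simp
  have "{0..\<gamma> * r} \<inter> {..v} = {0..v}" using assms by auto
  then show ?thesis
    using assms pos unfolding valuation_cdf_def cdf_def valuation_measure_def
    by (subst measure_uniform_measure) auto
qed

lemma valuation_density_eq: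
  assumes "\<gamma> > 0" "r > 0" "v \<in> {0..\<gamma> * r}"
  shows "valuation_density \<gamma> r v = 1 / (\<gamma> * r)"
  using assms by (simp add: valuation_density_def)

text \<open>The infimum in the price is the unique zero of the virtual valuation.\<close>

lemma price_unique_zero:
  assumes "\<gamma> > 0" "r > 0"
  shows "{b \<in> {0..\<gamma> * r}. virtual_valuation \<gamma> r b = 0} = {price \<gamma> r}"
proof -
  have pos: "\<gamma> * r > 0" using assms by simp
  have phi: "virtual_valuation \<gamma> r b = 2 * b - \<gamma> * r" if "b \<in> {0..\<gamma> * r}" for b
  proof -
    have "virtual_valuation \<gamma> r b = b - (1 - b / (\<gamma> * r)) / (1 / (\<gamma> * r))"
      unfolding virtual_valuation_def
      using valuation_cdf_eq[OF assms that] valuation_density_eq[OF assms that] by (simp only:)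
    also have "\<dots> = 2 * b - \<gamma> * r" using assms by (simp add: field_simps)
    finally show ?thesis .
  qed
  have "{b \<in> {0..\<gamma> * r}. virtual_valuation \<gamma> r b \<ge> 0} = {\<gamma> * r / 2..\<gamma> * r}" using phi pos by auto
  then have "price \<gamma> r = \<gamma> * r / 2" using pos by (simp add: price_def)
  then show ?thesis using phi pos by auto
qed

section \<open>Model of computation\<close>

text \<open>A unit-cost real random access machine with exact real arithmetic. A program is a finite
  list of instructions, and its only constants are integers. The bids form a read-only input list
  that is scanned from left to right by a head, and \<open>\<gamma>\<close> and \<open>r\<close> are given in registers 0 and 1.
  \<open>Emit\<close> appends the current head position, i.e. the number of the current customer, to the
  output. The machine halts when the program counter leaves the program.\<close>

datatype instr =
    Const nat int
  | Add nat nat nat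
  | Sub nat nat nat
  | Mul nat nat nat
  | Div nat nat nat
  | JumpLess nat nat nat
  | Jump nat
  | JumpEnd nat
  | Read nat
  | Advance
  | Emit

record config =
  pc :: nat
  reg :: "nat \<Rightarrow> real"
  head :: nat
  out :: "nat list"

definition init :: "real \<Rightarrow> real \<Rightarrow> config" where
  "init \<gamma> r = \<lparr>pc = 0, reg = (\<lambda>_. 0)(0 := \<gamma>, 1 := r), head = 0, out = []\<rparr>"

definition set_reg :: "nat \<Rightarrow> real \<Rightarrow> config \<Rightarrow> config" where
  "set_reg k x c = c\<lparr>reg := (reg c)(k := x), pc := Suc (pc c)\<rparr>"

text \<open>Division by 0 and reading behind the end of the input leave the configuration unchanged,
  so that the machine never halts.\<close>

fun exec_instr :: "real list \<Rightarrow> instr \<Rightarrow> config \<Rightarrow> config" where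
  "exec_instr b (Const k z) c = set_reg k (of_int z) c"
| "exec_instr b (Add k l m) c = set_reg k (reg c l + reg c m) c"
| "exec_instr b (Sub k l m) c = set_reg k (reg c l - reg c m) c"
| "exec_instr b (Mul k l m) c = set_reg k (reg c l * reg c m) c"
| "exec_instr b (Div k l m) c = (if reg c m = 0 then c else set_reg k (reg c l / reg c m) c)"
| "exec_instr b (JumpLess k l a) c = c\<lparr>pc := (if reg c k < reg c l then a else Suc (pc c))\<rparr>"
| "exec_instr b (Jump a) c = c\<lparr>pc := a\<rparr>"
| "exec_instr b (JumpEnd a) c = c\<lparr>pc := (if length b \<le> head c then a else Suc (pc c))\<rparr>"
| "exec_instr b (Read k) c = (if head c < length b then set_reg k (b ! head c) c else c)"
| "exec_instr b Advance c = c\<lparr>head := Suc (head c), pc := Suc (pc c)\<rparr>"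
| "exec_instr b Emit c = c\<lparr>out := out c @ [head c], pc := Suc (pc c)\<rparr>"

definition halted :: "instr list \<Rightarrow> config \<Rightarrow> bool" where
  "halted P c \<longleftrightarrow> length P \<le> pc c"

definition step :: "instr list \<Rightarrow> real list \<Rightarrow> config \<Rightarrow> config" where
  "step P b c = (if halted P c then c else exec_instr b (P ! pc c) c)"

definition run :: "instr list \<Rightarrow> real \<Rightarrow> real \<Rightarrow> real list \<Rightarrow> nat \<Rightarrow> config" where
  "run P \<gamma> r b t = (step P b ^^ t) (init \<gamma> r)"

fun is_arith_or_comparison :: "instr \<Rightarrow> bool" where
  "is_arith_or_comparison (Add k l m) = True"
| "is_arith_or_comparison (Sub k l m) = True"
| "is_arith_or_comparison (Mul k l m) = True"
| "is_arith_or_comparison (Div k l m) = True"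
| "is_arith_or_comparison (JumpLess k l a) = True"
| "is_arith_or_comparison _ = False"

text \<open>The times before \<open>n\<close> at which an arithmetic operation or a comparison is executed. An
  operation is attributed to the customer at whose bid the head is positioned.\<close>

definition op_times :: "instr list \<Rightarrow> real \<Rightarrow> real \<Rightarrow> real list \<Rightarrow> nat \<Rightarrow> nat set" where
  "op_times P \<gamma> r b n = {t. t < n \<and> \<not> halted P (run P \<gamma> r b t) \<and>
     is_arith_or_comparison (P ! pc (run P \<gamma> r b t))}"

definition customer_op_times ::
  "instr list \<Rightarrow> real \<Rightarrow> real \<Rightarrow> real list \<Rightarrow> nat \<Rightarrow> nat \<Rightarrow> nat set" where
  "customer_op_times P \<gamma> r b n i = {t \<in> op_times P \<gamma> r b n. head (run P \<gamma> r b t) = i}"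

end

theory Submission
  imports Defs
begin

text \<open>For uniform valuations \<open>\<phi>(b) = 2 b - \<gamma> r\<close>, so the auction is a posted price \<open>\<gamma> r / 2\<close>, and
  bidding truthfully means buying exactly when the valuation reaches that price. A machine decides
  \<open>\<phi>(b) \<ge> 0\<close> with one addition, one multiplication and one comparison per customer.\<close>

lemma virtual_valuation_eq:
  assumes "\<gamma> > 0" "r > 0" "b \<in> {0..\<gamma> * r}"
  shows "virtual_valuation \<gamma> r b = 2 * b - \<gamma> * r"
  using assms(1,2)
  by (simp add: virtual_valuation_def valuation_cdf_eq[OF assms] valuation_density_eq[OF assms]
      field_simps)

text \<open>The price lies in the singleton of zeros of the virtual valuation, and the affine
  formula for \<phi> then determines its value.\<close>

lemma price_eq:
  assumes "\<gamma> > 0" "r > 0"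
  shows "price \<gamma> r = \<gamma> * r / 2"
proof -
  have "price \<gamma> r \<in> {b \<in> {0..\<gamma> * r}. virtual_valuation \<gamma> r b = 0}"
    unfolding price_unique_zero[OF assms] by simp
  then show ?thesis using virtual_valuation_eq[OF assms, of "price \<gamma> r"] by simp
qed

text \<open>Stated with the losing case first, so that the strict inequality is exactly the test
  made by \<open>JumpLess\<close>; a bid equal to the price wins.\<close>

lemma allocation_eq:
  assumes "\<gamma> > 0" "r > 0" "b ! i \<in> {0..\<gamma> * r}"
  shows "allocation \<gamma> r b i = (if 2 * (b ! i) < \<gamma> * r then 0 else 1)"
  using virtual_valuation_eq[OF assms] by (simp add: allocation_def)

lemma nth_with_bid: "i \<le> length bs \<Longrightarrow> with_bid i w bs ! i = w"
  by (simp add: with_bid_def nth_append)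

text \<open>The bid \<open>w\<close> only selects between the outcomes 0 and
  \<open>v - \<gamma> * r / 2\<close>, neither of which depends on \<open>w\<close>. Choosing
  \<open>w = v\<close> selects the larger one, which is nonnegative; this yields both incentive
  compatibility and individual rationality.\<close>

lemma utility_with_bid:
  assumes "\<gamma> > 0" "r > 0" "w \<in> {0..\<gamma> * r}" "i < M" "bs \<in> bid_profiles (M - 1) \<gamma> r"
  shows "utility \<gamma> r v i (with_bid i w bs) = (if 2 * w < \<gamma> * r then 0 else v - \<gamma> * r / 2)"
proof -
  have "with_bid i w bs ! i = w"
    using assms(4,5) by (intro nth_with_bid) (auto simp: bid_profiles_def)
  with assms show ?thesis
    by (simp add: utility_def payment_def allocation_eq price_eq)
qed

text \<open>A loser takes the detour through instruction 8, so that every customer costs exactly 8 steps.\<close>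

definition winners_program :: "instr list" where
  "winners_program =
    [JumpEnd 9, Read 2, Add 2 2 2, Mul 3 0 1, JumpLess 2 3 8, Emit, Advance, Jump 0, Jump 6]"

text \<open>Symbolic execution of one pass of the loop. All intermediate configurations are
  recorded, since counting operations per customer needs the program counter and the head at every
  step.\<close>

lemma winners_program_trajectory:
  fixes b c
  defines "s \<equiv> \<lambda>j. (step winners_program b ^^ j) c"
    and "loses \<equiv> 2 * (b ! head c) < reg c 0 * reg c 1"
    and "c' \<equiv> c\<lparr>reg := (reg c)(2 := 2 * (b ! head c), 3 := reg c 0 * reg c 1)\<rparr>"
  assumes pc: "pc c = 0" and head: "head c < length b"
  shows "s 0 = c"
    and "s 1 = c\<lparr>pc := 1\<rparr>"
    and "s 2 = c\<lparr>reg := (reg c)(2 := b ! head c), pc := 2\<rparr>"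
    and "s 3 = c\<lparr>reg := (reg c)(2 := 2 * (b ! head c)), pc := 3\<rparr>"
    and "s 4 = c'\<lparr>pc := 4\<rparr>"
    and "s 5 = c'\<lparr>pc := if loses then 8 else 5\<rparr>"
    and "s 6 = c'\<lparr>out := out c @ (if loses then [] else [head c]), pc := 6\<rparr>"
    and "s 7 = c'\<lparr>out := out c @ (if loses then [] else [head c]), head := Suc (head c), pc := 7\<rparr>"
    and "s 8 = c'\<lparr>out := out c @ (if loses then [] else [head c]), head := Suc (head c), pc := 0\<rparr>"
proof -
  have Suc: "s (Suc j) = step winners_program b (s j)" for j by (simp add: s_def)
  note exec = step_def halted_def winners_program_def set_reg_def c'_def
  show s0: "s 0 = c" by (simp add: s_def)
  show s1: "s 1 = c\<lparr>pc := 1\<rparr>"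
    using Suc[of 0] pc head unfolding s0 by (simp add: exec)
  show s2: "s 2 = c\<lparr>reg := (reg c)(2 := b ! head c), pc := 2\<rparr>"
    using Suc[of 1] head unfolding s1 by (simp add: exec numeral_2_eq_2)
  show s3: "s 3 = c\<lparr>reg := (reg c)(2 := 2 * (b ! head c)), pc := 3\<rparr>"
    using Suc[of 2] unfolding s2 by (simp add: exec)
  show s4: "s 4 = c'\<lparr>pc := 4\<rparr>"
    using Suc[of 3] unfolding s3 by (simp add: exec)
  show s5: "s 5 = c'\<lparr>pc := if loses then 8 else 5\<rparr>"
    using Suc[of 4] unfolding s4 by (simp add: exec loses_def)
  \<comment> \<open>The branches rejoin here: a loser arrives by \<open>Jump 6\<close>, a winner by
    falling through \<open>Emit\<close>.\<close>
  show s6: "s 6 = c'\<lparr>out := out c @ (if loses then [] else [head c]), pc := 6\<rparr>"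
    using Suc[of 5] unfolding s5 by (cases loses) (simp_all add: exec)
  show s7: "s 7 = c'\<lparr>out := out c @ (if loses then [] else [head c]), head := Suc (head c), pc := 7\<rparr>"
    using Suc[of 6] unfolding s6 by (simp add: exec)
  show "s 8 = c'\<lparr>out := out c @ (if loses then [] else [head c]), head := Suc (head c), pc := 0\<rparr>"
    using Suc[of 7] unfolding s7 by (simp add: exec)
qed

text \<open>Only \<open>Add\<close>, \<open>Mul\<close> and \<open>JumpLess\<close> count, and they
  run at times 2, 3 and 4 of a pass. The head moves later, at \<open>Advance\<close>, so all three
  are charged to the same customer.\<close>

lemma winners_program_iteration_op:
  assumes "pc c = 0" "head c < length b" "j < 8"
    and "is_arith_or_comparison (winners_program ! pc ((step winners_program b ^^ j) c))"
  shows "j \<in> {2, 3, 4} \<and> head ((step winners_program b ^^ j) c) = head c"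
proof -
  note s = winners_program_trajectory[OF assms(1,2)]
  consider "j = 0" | "j = 1" | "j = 2" | "j = 3" | "j = 4" | "j = 5" | "j = 6" | "j = 7"
    using assms(3) by linarith
  then show ?thesis
    using assms(4) by cases
      (simp_all only: s, simp_all add: winners_program_def assms(1) split: if_splits)
qed

lemma run_add: "run P \<gamma> r b (s + t) = (step P b ^^ t) (run P \<gamma> r b s)"
  unfolding run_def by (subst add.commute) (simp add: funpow_add)

text \<open>As every pass takes 8 steps, customer \<open>k\<close> begins at time
  \<open>8 * k\<close> whatever the earlier outcomes were. Registers 0 and 1 survive because the
  program writes only to registers 2 and 3.\<close>

lemma winners_program_invariant:
  fixes \<gamma> r b
  defines "c \<equiv> \<lambda>k. run winners_program \<gamma> r b (8 * k)"
  assumes "k \<le> length b"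
  shows "pc (c k) = 0 \<and> head (c k) = k \<and> reg (c k) 0 = \<gamma> \<and> reg (c k) 1 = r \<and>
    out (c k) = filter (\<lambda>i. \<not> 2 * (b ! i) < \<gamma> * r) [0..<k]"
  using assms(2)
proof (induction k)
  case 0
  show ?case by (simp add: c_def run_def init_def)
next
  case (Suc k)
  have "c (Suc k) = (step winners_program b ^^ 8) (c k)"
    unfolding c_def by (subst run_add[symmetric]) (simp add: add.commute)
  with Suc winners_program_trajectory(9)[of "c k" b] show ?case by simp
qed

text \<open>The one additional step is the final \<open>JumpEnd 9\<close>, which leaves the program
  of length 9.\<close>

lemma winners_program_halts:
  defines "c \<equiv> \<lambda>b \<gamma> r. run winners_program \<gamma> r b (8 * length b + 1)"
  shows "halted winners_program (c b \<gamma> r)"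
    and "out (c b \<gamma> r) = filter (\<lambda>i. \<not> 2 * (b ! i) < \<gamma> * r) [0..<length b]"
  unfolding c_def run_add using winners_program_invariant[of "length b" b \<gamma> r]
  by (simp_all add: step_def halted_def winners_program_def)

text \<open>Division of \<open>t\<close> by 8 gives the customer as quotient and the time within the
  pass as remainder.\<close>

lemma winners_program_op_time:
  assumes "t \<in> op_times winners_program \<gamma> r b (8 * length b + 1)"
  obtains k where "k < length b" "head (run winners_program \<gamma> r b t) = k"
    "t \<in> {8 * k + 2, 8 * k + 3, 8 * k + 4}"
proof -
  let ?k = "t div 8" and ?j = "t mod 8"
  have arith: "is_arith_or_comparison (winners_program ! pc (run winners_program \<gamma> r b t))"
    and t: "t < 8 * length b + 1"
    using assms by (simp_all add: op_times_def)
  \<comment> \<open>At this last time the machine executes \<open>JumpEnd\<close>, which is not a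
    counted operation; hence \<open>t\<close> falls into a complete pass.\<close>
  have "t \<noteq> 8 * length b"
    using arith winners_program_invariant[of "length b" b \<gamma> r] by (auto simp: winners_program_def)
  with t have k: "?k < length b" by linarith
  have split: "run winners_program \<gamma> r b t =
      (step winners_program b ^^ ?j) (run winners_program \<gamma> r b (8 * ?k))"
    by (subst run_add[symmetric]) simp
  have "?j \<in> {2, 3, 4} \<and> head (run winners_program \<gamma> r b t) = ?k"
    using winners_program_iteration_op[of "run winners_program \<gamma> r b (8 * ?k)" b ?j]
      winners_program_invariant[of ?k b \<gamma> r] k arith split by simp
  moreover from this have "t \<in> {8 * ?k + 2, 8 * ?k + 3, 8 * ?k + 4}"
    using mult_div_mod_eq[of 8 t] by (metis insert_iff singletonD)
  ultimately show thesis using k that[of ?k] by blast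
qed

lemma card_op_times:
  "card (op_times winners_program \<gamma> r b (8 * length b + 1)) \<le> 3 * length b"
proof -
  let ?A = "\<lambda>k. {8 * k + 2, 8 * k + 3, 8 * k + 4 :: nat}"
  have "op_times winners_program \<gamma> r b (8 * length b + 1) \<subseteq> (\<Union>k<length b. ?A k)"
    by (blast elim: winners_program_op_time)
  then have "card (op_times winners_program \<gamma> r b (8 * length b + 1)) \<le> card (\<Union>k<length b. ?A k)"
    by (intro card_mono) auto
  also have "\<dots> \<le> (\<Sum>k<length b. card (?A k))" by (intro card_UN_le) simp
  finally show ?thesis by simp
qed

text \<open>The head position identifies the pass, so the operations charged to customer
  \<open>i\<close> all lie in block \<open>i\<close> of the time axis.\<close>

lemma card_customer_op_times:
  "card (customer_op_times winners_program \<gamma> r b (8 * length b + 1) i) \<le> 3"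
proof -
  have "customer_op_times winners_program \<gamma> r b (8 * length b + 1) i
      \<subseteq> {8 * i + 2, 8 * i + 3, 8 * i + 4}"
    unfolding customer_op_times_def by (blast elim: winners_program_op_time)
  then have "card (customer_op_times winners_program \<gamma> r b (8 * length b + 1) i)
      \<le> card {8 * i + 2, 8 * i + 3, 8 * i + 4}"
    by (intro card_mono) auto
  then show ?thesis by simp
qed

lemma winners_eq:
  assumes "\<gamma> > 0" "r > 0" "b \<in> bid_profiles M \<gamma> r"
  shows "winners \<gamma> r b = filter (\<lambda>i. \<not> 2 * (b ! i) < \<gamma> * r) [0..<length b]"
proof -
  \<comment> \<open>The affine formula for \<phi> is available only on the valuation interval, where
    the density is positive.\<close>
  have "b ! i \<in> {0..\<gamma> * r}" if "i < length b" for i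
    using assms(3) nth_mem[OF that] unfolding bid_profiles_def by blast
  then show ?thesis
    unfolding winners_def by (intro filter_cong) (auto simp: allocation_eq[OF assms(1,2)])
qed

theorem mainTheorem1:
  shows
   "(\<forall>(M::nat) (\<gamma>::real) (r::real). M \<ge> 1 \<and> \<gamma> > 0 \<and> r > 0 \<longrightarrow>
       (\<forall>i<M. \<forall>v\<in>{0..\<gamma> * r}. \<forall>bs\<in>bid_profiles (M - 1) \<gamma> r. \<forall>w\<in>{0..\<gamma> * r}.
          utility \<gamma> r v i (with_bid i v bs) \<ge> utility \<gamma> r v i (with_bid i w bs)))
    \<and>
    (\<forall>(M::nat) (\<gamma>::real) (r::real). M \<ge> 1 \<and> \<gamma> > 0 \<and> r > 0 \<longrightarrow>
       (\<forall>i<M. \<forall>v\<in>{0..\<gamma> * r}. \<forall>bs\<in>bid_profiles (M - 1) \<gamma> r.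
          utility \<gamma> r v i (with_bid i v bs) \<ge> 0))
    \<and>
    (\<exists>(P::instr list) (p::nat poly) (C::nat).
       \<forall>(M::nat) (\<gamma>::real) (r::real). M \<ge> 1 \<and> \<gamma> > 0 \<and> r > 0 \<longrightarrow>
       (\<forall>b\<in>bid_profiles M \<gamma> r. \<exists>n.
          n \<le> poly p M \<and>
          halted P (run P \<gamma> r b n) \<and>
          out (run P \<gamma> r b n) = winners \<gamma> r b \<and>
          card (op_times P \<gamma> r b n) \<le> C * M \<and>
          (\<forall>i<M. card (customer_op_times P \<gamma> r b n i) \<le> C)))"
proof (intro conjI)
  show "\<forall>(M::nat) (\<gamma>::real) (r::real). M \<ge> 1 \<and> \<gamma> > 0 \<and> r > 0 \<longrightarrow>
       (\<forall>i<M. \<forall>v\<in>{0..\<gamma> * r}. \<forall>bs\<in>bid_profiles (M - 1) \<gamma> r. \<forall>w\<in>{0..\<gamma> * r}.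
          utility \<gamma> r v i (with_bid i v bs) \<ge> utility \<gamma> r v i (with_bid i w bs))"
    by (simp add: utility_with_bid)
  show "\<forall>(M::nat) (\<gamma>::real) (r::real). M \<ge> 1 \<and> \<gamma> > 0 \<and> r > 0 \<longrightarrow>
       (\<forall>i<M. \<forall>v\<in>{0..\<gamma> * r}. \<forall>bs\<in>bid_profiles (M - 1) \<gamma> r.
          utility \<gamma> r v i (with_bid i v bs) \<ge> 0)"
    by (simp add: utility_with_bid)
  \<comment> \<open>The polynomial is \<open>1 + 8 * M\<close>: 8 steps per customer and one to
    exit. The constant 3 counts one addition, one multiplication and one comparison. None of the
    witnesses depends on \<open>M\<close>, \<gamma>, \<open>r\<close> or the bids.\<close>
  have "8 * M + 1 \<le> poly [:1, 8:] M \<and>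
      halted winners_program (run winners_program \<gamma> r b (8 * M + 1)) \<and>
      out (run winners_program \<gamma> r b (8 * M + 1)) = winners \<gamma> r b \<and>
      card (op_times winners_program \<gamma> r b (8 * M + 1)) \<le> 3 * M \<and>
      (\<forall>i<M. card (customer_op_times winners_program \<gamma> r b (8 * M + 1) i) \<le> 3)"
    if "\<gamma> > 0" "r > 0" "b \<in> bid_profiles M \<gamma> r" for M \<gamma> r b
  proof -
    have "length b = M" using that(3) by (simp add: bid_profiles_def)
    then show ?thesis
      using winners_program_halts[of \<gamma> r b] card_op_times[of \<gamma> r b]
        card_customer_op_times[of \<gamma> r b] winners_eq[OF that] by simp
  qed
  then show "\<exists>(P::instr list) (p::nat poly) (C::nat).
       \<forall>(M::nat) (\<gamma>::real) (r::real). M \<ge> 1 \<and> \<gamma> > 0 \<and> r > 0 \<longrightarrow>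
       (\<forall>b\<in>bid_profiles M \<gamma> r. \<exists>n.
          n \<le> poly p M \<and>
          halted P (run P \<gamma> r b n) \<and>
          out (run P \<gamma> r b n) = winners \<gamma> r b \<and>
          card (op_times P \<gamma> r b n) \<le> C * M \<and>
          (\<forall>i<M. card (customer_op_times P \<gamma> r b n i) \<le> C))"
    by blast
qed

end
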